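(* Let $m$ be an odd number whose root $a$ (defined by $m = 2a+1$) is even. Then the next value of the sequence after one reduced Collatz iteration is less than $m$; that is, $$\frac{3m+1}{2^x} < m,$$ where $x$ is the largest exponent such that $2^x$ divides $3m+1$.
   Context: Numbers are positive integers. For an odd number $m$, the root of $m$ is the integer $a \ge 0$ with $m = 2a+1$. The reduced Collatz iteration sends an odd number $m$ to $R(m) = \frac{3m+1}{2^x}$, where $2^x$ is the highest power of $2$ dividing $3m+1$; iterating it produces the sequence referred to in the claim.
   Formalization: The case m = 1 is excluded: its root a = 0 is even, but the next value is 4/4 = 1, which is not less than m, so the claim fails there; all other odd m with even root are covered. *)

theory Defs
  imports "HOL-Computational_Algebra.Primes"
begin

text \<open>The root of an odd number; meaningful only for odd arguments, where it exists uniquely.\<close>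

definition odd_root :: "nat \<Rightarrow> nat" where
  "odd_root m = (THE a. m = 2 * a + 1)"

lemma odd_root_eq: "odd_root (2 * a + 1) = a"
  unfolding odd_root_def by (rule the_equality) auto

text \<open>The exponent is the largest x such that 2^x divides 3m+1, so the division is exact.\<close>

definition reduced_collatz :: "nat \<Rightarrow> nat" where
  "reduced_collatz m = (3 * m + 1) div 2 ^ multiplicity 2 (3 * m + 1)"

lemma reduced_collatz_exact:
  "reduced_collatz m * 2 ^ multiplicity 2 (3 * m + 1) = 3 * m + 1"
  unfolding reduced_collatz_def by (rule dvd_div_mult_self[OF multiplicity_dvd])

text \<open>The number 1 has the even root 0 and is a fixed point of the iteration, so strict descent
  from an even root can hold only for m different from 1.\<close>

lemma odd_root_1: "odd_root 1 = 0"
  using odd_root_eq[of 0] by simp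

lemma reduced_collatz_1: "reduced_collatz 1 = 1"
proof -
  have "multiplicity 2 (2 ^ 2 :: nat) = 2"
    by (rule multiplicity_same_power) auto
  then show ?thesis
    unfolding reduced_collatz_def by simp
qed

end

theory Submission
  imports Defs
begin

text \<open>An even root means that \<open>m\<close> is 1 modulo 4, so 4 divides
  \<open>3 * m + 1\<close> and the iteration divides by at least 4. The result is at most
  \<open>(3 * m + 1) / 4\<close>, which is below \<open>m\<close> as soon as
  \<open>m > 1\<close>.\<close>

theorem theorem2:
  fixes m :: nat
  assumes "odd m" and "m \<noteq> 1" and "even (odd_root m)"
  shows "reduced_collatz m < m"
proof -
  obtain a where a: "m = 2 * a + 1"
    using \<open>odd m\<close> by (rule oddE)
  then have "even a"
    using \<open>even (odd_root m)\<close> by (simp only: odd_root_eq)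
  then obtain b where "a = 2 * b"
    by (rule evenE)
  with a have m: "m = 4 * b + 1" by simp
  with \<open>m \<noteq> 1\<close> have "m > 1" by simp
  have "3 * m + 1 = 2 ^ 2 * (3 * b + 1)"
    using m by simp
  then have "2 ^ 2 dvd 3 * m + 1"
    by (rule dvdI)
  then have "2 \<le> multiplicity 2 (3 * m + 1)"
    by (intro multiplicity_geI) auto
  then have "(2::nat) ^ 2 \<le> 2 ^ multiplicity 2 (3 * m + 1)"
    by (rule power_increasing) simp
  \<comment> \<open>Exactness of the division turns the bound on the power into one free of
    \<open>div\<close>; then \<open>3 * m + 1 < 4 * m\<close> concludes.\<close>
  then have "reduced_collatz m * 2 ^ 2 \<le> 3 * m + 1"
    by (metis mult_le_mono2 reduced_collatz_exact)
  with \<open>m > 1\<close> show ?thesis by simp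
qed

end
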